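(* Let $n\geq 1$ and $m\geq n$ be integers, and let the processing times $t_{ij}$ ($i\in\{1,\dots,n\}$, $j\in\{1,\dots,m\}$) be i.i.d. random variables drawn either from the uniform distribution on $[0,1]$ or from an exponential distribution (with any parameter $\lambda>0$). Then $$\mathbb E[\mathrm{VCG}(\mathbf t)]\leq 4\,\mathbb E[\mathrm{OPT}(\mathbf t)].$$
   Context: There are $n$ machines and $m\ge n$ tasks; $t_{ij}\ge 0$ is the processing time of task $j$ on machine $i$, and $\mathbf t=(t_{ij})$. The VCG allocation assigns each task $j$ to a machine $i$ with $t_{ij}=\min_{i'}t_{i'j}$, ties (which have probability zero here) being broken uniformly at random. With $\alpha_{ij}\in\{0,1\}$ indicating whether VCG assigns task $j$ to machine $i$, $\mathrm{VCG}(\mathbf t)=\max_i\sum_{j=1}^m\alpha_{ij}t_{ij}$ is its makespan. $\mathrm{OPT}(\mathbf t)$ is the minimum, over all assignments $a:\{1,\dots,m\}\to\{1,\dots,n\}$ of tasks to machines, of the makespan $\max_i\sum_{j:a(j)=i}t_{ij}$. *)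

theory Defs
  imports "HOL-Probability.Probability"
begin

text \<open>
  Machines are \<open>1,\<dots>,n\<close>, tasks are \<open>1,\<dots>,m\<close>, and \<open>t i j\<close> is the processing time of
  task \<open>j\<close> on machine \<open>i\<close>. An assignment \<open>a\<close> sends task \<open>j\<close> to machine \<open>a j\<close>.
\<close>

definition makespan :: "nat \<Rightarrow> nat \<Rightarrow> (nat \<Rightarrow> nat \<Rightarrow> real) \<Rightarrow> (nat \<Rightarrow> nat) \<Rightarrow> real" where
  "makespan n m t a = Max ((\<lambda>i. \<Sum>j\<in>{j \<in> {1..m}. a j = i}. t i j) ` {1..n})"

definition OPT :: "nat \<Rightarrow> nat \<Rightarrow> (nat \<Rightarrow> nat \<Rightarrow> real) \<Rightarrow> real" where
  "OPT n m t = Min (makespan n m t ` ({1..m} \<rightarrow>\<^sub>E {1..n}))"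

definition fastest_machines :: "nat \<Rightarrow> (nat \<Rightarrow> nat \<Rightarrow> real) \<Rightarrow> nat \<Rightarrow> nat set" where
  "fastest_machines n t j = {i \<in> {1..n}. t i j = Min ((\<lambda>i'. t i' j) ` {1..n})}"

text \<open>Ties are broken uniformly at random, independently for the different tasks.\<close>

definition VCG_allocation :: "nat \<Rightarrow> nat \<Rightarrow> (nat \<Rightarrow> nat \<Rightarrow> real) \<Rightarrow> (nat \<Rightarrow> nat) pmf" where
  "VCG_allocation n m t =
     Pi_pmf {1..m} undefined (\<lambda>j. pmf_of_set (fastest_machines n t j))"

definition VCG :: "nat \<Rightarrow> nat \<Rightarrow> (nat \<Rightarrow> nat \<Rightarrow> real) \<Rightarrow> real pmf" where
  "VCG n m t = map_pmf (makespan n m t) (VCG_allocation n m t)"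

text \<open>
  \<open>VCG n m t\<close> is the law of the makespan for a fixed matrix \<open>t\<close>; the only randomness left is
  the tie-breaking, and it is averaged out here. For a random matrix, the expected makespan is
  the expectation of \<open>expected_VCG\<close> over that matrix.
\<close>

definition expected_VCG :: "nat \<Rightarrow> nat \<Rightarrow> (nat \<Rightarrow> nat \<Rightarrow> real) \<Rightarrow> real" where
  "expected_VCG n m t = measure_pmf.expectation (VCG n m t) (\<lambda>x. x)"

end

theory Submission
  imports Defs "HOL-Real_Asymp.Real_Asymp"
begin

text \<open>
  Let \<open>X j\<close> be the minimum of \<open>t i j\<close> over the machines \<open>i\<close>, and \<open>\<mu>\<close> its mean. Since \<open>OPT\<close> is at
  least every \<open>X j\<close> and at least \<open>(\<Sum>j. X j) / n\<close>, its expectation is at least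
  \<open>E (max j. X j) \<ge> \<mu> * ln n\<close> and at least \<open>\<mu> * m / n\<close>. Under VCG the load of machine \<open>i\<close> is a sum of
  \<open>m\<close> independent terms that equal \<open>X j\<close> with probability \<open>1 / n\<close> and \<open>0\<close> otherwise; as
  \<open>E (exp (X j / (2 * \<mu>))) \<le> 2\<close> for both distributions, the exponential moment of the load is at
  most \<open>(1 + 1 / n) ^ m \<le> exp (m / n)\<close>. Summing over the machines, the expected makespan is at most
  \<open>2 * \<mu> * ln (n * exp (m / n)) = 2 * \<mu> * (ln n + m / n)\<close>.
\<close>

section \<open>Pointwise bounds for a fixed matrix of processing times\<close>

text \<open>Whichever machine receives task \<open>j\<close>, its load contains the term of
  \<open>j\<close>. Since the other terms are nonnegative, that load, and with it the makespan, is
  at least the smallest time of \<open>j\<close>.\<close>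

lemma min_time_le_OPT:
  fixes t :: "nat \<Rightarrow> nat \<Rightarrow> real"
  assumes n: "n \<ge> 1" and t: "\<And>i j. i \<in> {1..n} \<Longrightarrow> j \<in> {1..m} \<Longrightarrow> 0 \<le> t i j" and j: "j \<in> {1..m}"
  shows "Min ((\<lambda>i. t i j) ` {1..n}) \<le> OPT n m t"
proof -
  have "Min ((\<lambda>i. t i j) ` {1..n}) \<le> makespan n m t a" if a: "a \<in> {1..m} \<rightarrow>\<^sub>E {1..n}" for a
  proof -
    from a j have aj: "a j \<in> {1..n}" by auto
    have "Min ((\<lambda>i. t i j) ` {1..n}) \<le> t (a j) j"
      using aj by (intro Min_le) auto
    also have "\<dots> \<le> (\<Sum>k\<in>{k \<in> {1..m}. a k = a j}. t (a j) k)"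
      using j aj by (intro member_le_sum) (auto intro: t)
    also have "\<dots> \<le> makespan n m t a"
      unfolding makespan_def using aj by (intro Max_ge) auto
    finally show ?thesis .
  qed
  moreover have "({1..m} \<rightarrow>\<^sub>E {1..n}) \<noteq> {}" using n by (auto simp: PiE_eq_empty_iff)
  ultimately show ?thesis
    unfolding OPT_def by (subst Min_ge_iff) (auto simp: finite_PiE)
qed

text \<open>The largest of the \<open>n\<close> loads of an optimal assignment is at least their
  average, and the loads add up to the total time spent, in which each task contributes at least its
  minimum.\<close>

lemma sum_min_time_le_OPT:
  fixes t :: "nat \<Rightarrow> nat \<Rightarrow> real"
  assumes n: "n \<ge> 1"
  shows "(\<Sum>j\<in>{1..m}. Min ((\<lambda>i. t i j) ` {1..n})) \<le> n * OPT n m t"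
proof -
  have "({1..m} \<rightarrow>\<^sub>E {1..n}) \<noteq> {}" using n by (auto simp: PiE_eq_empty_iff)
  then have "OPT n m t \<in> makespan n m t ` ({1..m} \<rightarrow>\<^sub>E {1..n})"
    unfolding OPT_def by (intro Min_in) (auto simp: finite_PiE)
  then obtain a where a: "a \<in> {1..m} \<rightarrow>\<^sub>E {1..n}" and opt: "OPT n m t = makespan n m t a" by auto
  have "(\<Sum>j\<in>{1..m}. Min ((\<lambda>i. t i j) ` {1..n})) \<le> (\<Sum>j\<in>{1..m}. t (a j) j)"
    using a by (intro sum_mono Min_le) auto
  also have "\<dots> = (\<Sum>i\<in>{1..n}. \<Sum>j\<in>{j \<in> {1..m}. a j = i}. t (a j) j)"
    using a by (subst sum.group) auto
  also have "\<dots> = (\<Sum>i\<in>{1..n}. \<Sum>j\<in>{j \<in> {1..m}. a j = i}. t i j)"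
    by (intro sum.cong) auto
  also have "\<dots> \<le> (\<Sum>i\<in>{1..n}. makespan n m t a)"
    unfolding makespan_def by (intro sum_mono Max_ge) auto
  finally show ?thesis by (simp add: opt)
qed

text \<open>A task with several fastest machines is charged to each of them. This deterministic
  quantity thus dominates the VCG load under every tie-breaking, and its summands depend on one
  column each.\<close>

definition fastest_load :: "nat \<Rightarrow> nat \<Rightarrow> (nat \<Rightarrow> nat \<Rightarrow> real) \<Rightarrow> nat \<Rightarrow> real" where
  "fastest_load n m t i = (\<Sum>j\<in>{1..m}. if \<forall>i'\<in>{1..n}. t i j \<le> t i' j then t i j else 0)"

text \<open>Every allocation in the support of \<open>VCG_allocation\<close> uses only fastest
  machines. The bound therefore holds for each outcome of the tie-breaking and survives
  averaging.\<close>

lemma expected_VCG_le_max_fastest_load: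
  fixes t :: "nat \<Rightarrow> nat \<Rightarrow> real"
  assumes n: "n \<ge> 1" and t: "\<And>i j. i \<in> {1..n} \<Longrightarrow> j \<in> {1..m} \<Longrightarrow> 0 \<le> t i j"
  shows "expected_VCG n m t \<le> Max (fastest_load n m t ` {1..n})"
proof -
  have fin: "finite (fastest_machines n t j)" for j
    by (simp add: fastest_machines_def)
  have ne: "fastest_machines n t j \<noteq> {}" for j
  proof -
    have "Min ((\<lambda>i'. t i' j) ` {1..n}) \<in> (\<lambda>i'. t i' j) ` {1..n}"
      using n by (intro Min_in) auto
    then show ?thesis by (auto simp: fastest_machines_def)
  qed
  have bound: "makespan n m t a \<le> Max (fastest_load n m t ` {1..n})"
    if a: "a \<in> set_pmf (VCG_allocation n m t)" for a
  proof -
    have fast: "a j \<in> fastest_machines n t j" if "j \<in> {1..m}" for j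
      using a that by (auto simp: VCG_allocation_def set_Pi_pmf PiE_dflt_def set_pmf_of_set fin ne)
    have "(\<Sum>j\<in>{j \<in> {1..m}. a j = i}. t i j) \<le> fastest_load n m t i" if i: "i \<in> {1..n}" for i
    proof -
      have "(\<Sum>j\<in>{j \<in> {1..m}. a j = i}. t i j) = (\<Sum>j\<in>{1..m}. if a j = i then t i j else 0)"
        by (rule sum.inter_filter) simp
      also have "\<dots> \<le> fastest_load n m t i"
        unfolding fastest_load_def
        using fast t[OF i] by (intro sum_mono) (auto simp: fastest_machines_def)
      finally show ?thesis .
    qed
    then show ?thesis
      unfolding makespan_def using n
      by (intro Max.boundedI) (auto intro!: order_trans[OF _ Max_ge[OF _ imageI]])
  qed
  have "measure_pmf.expectation (VCG_allocation n m t) (makespan n m t)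
      \<le> Max (fastest_load n m t ` {1..n})"
  \<comment> \<open>Integrability comes from finite support: there are only finitely many ways to
    break the ties.\<close>
  proof (intro measure_pmf.integral_le_const integrable_measure_pmf_finite)
    show "finite (set_pmf (VCG_allocation n m t))"
      unfolding VCG_allocation_def
      by (rule finite_subset[OF set_Pi_pmf_subset'])
         (auto intro!: finite_PiE_dflt simp: set_pmf_of_set fin ne)
  qed (use bound in \<open>auto simp: AE_measure_pmf_iff\<close>)
  then show ?thesis by (simp add: expected_VCG_def VCG_def)
qed

section \<open>Tail integrals, product measures and independent columns\<close>

text \<open>Layer-cake formula: \<open>ennreal (X \<omega>)\<close> is the length of
  \<open>{0..<X \<omega>}\<close>, both being zero for negative \<open>X \<omega>\<close>, and the
  two integrals are exchanged by Fubini.\<close>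

lemma (in sigma_finite_measure) nn_integral_eq_tail:
  fixes X :: "'a \<Rightarrow> real"
  assumes [measurable]: "X \<in> borel_measurable M"
  shows "(\<integral>\<^sup>+\<omega>. ennreal (X \<omega>) \<partial>M)
    = (\<integral>\<^sup>+x\<in>{0..}. emeasure M {\<omega> \<in> space M. x < X \<omega>} \<partial>lborel)"
proof -
  interpret pair_sigma_finite M lborel ..
  have "(\<integral>\<^sup>+\<omega>. ennreal (X \<omega>) \<partial>M) = (\<integral>\<^sup>+\<omega>. (\<integral>\<^sup>+x. indicator {0..<X \<omega>} x \<partial>lborel) \<partial>M)"
    by (intro nn_integral_cong)
       (metis emeasure_lborel_Ico atLeastLessThan_empty diff_zero emeasure_empty ennreal_neg
         linear nn_integral_indicator sets_lborel atLeastLessThan_borel)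
  also have "\<dots> = (\<integral>\<^sup>+\<omega>. (\<integral>\<^sup>+x. indicator {0..} x * indicator {x. x < X \<omega>} x \<partial>lborel) \<partial>M)"
    by (intro nn_integral_cong) (auto split: split_indicator)
  also have "\<dots> = (\<integral>\<^sup>+x. (\<integral>\<^sup>+\<omega>. indicator {0..} x * indicator {x. x < X \<omega>} x \<partial>M) \<partial>lborel)"
    by (rule Fubini'[symmetric]) simp
  also have "\<dots> = (\<integral>\<^sup>+x\<in>{0..}. emeasure M {\<omega> \<in> space M. x < X \<omega>} \<partial>lborel)"
  proof (intro nn_integral_cong)
    fix x :: real
    have "(\<integral>\<^sup>+\<omega>. indicator {0..} x * indicator {x. x < X \<omega>} x \<partial>M)
        = (\<integral>\<^sup>+\<omega>. indicator {0..} x * indicator {\<omega> \<in> space M. x < X \<omega>} \<omega> \<partial>M)"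
      by (intro nn_integral_cong) (auto split: split_indicator)
    also have "\<dots> = indicator {0..} x * emeasure M {\<omega> \<in> space M. x < X \<omega>}"
      by (subst nn_integral_cmult) auto
    finally show "(\<integral>\<^sup>+\<omega>. indicator {0..} x * indicator {x. x < X \<omega>} x \<partial>M)
        = emeasure M {\<omega> \<in> space M. x < X \<omega>} * indicator {0..} x"
      by (simp add: mult.commute)
  qed
  finally show ?thesis .
qed

text \<open>The event is a box. It is used for the tail of the minimum of one column.\<close>

lemma emeasure_PiM_all_gt:
  fixes D :: "real measure"
  assumes "prob_space D" and [measurable_cong]: "sets D = sets borel" and "finite I"
  shows "emeasure (PiM I (\<lambda>_. D)) {y \<in> space (PiM I (\<lambda>_. D)). \<forall>i\<in>I. x < y i}
    = emeasure D {x<..} ^ card I"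
proof -
  interpret D: prob_space D by fact
  interpret product_sigma_finite "\<lambda>_. D" ..
  have "{y \<in> space (PiM I (\<lambda>_. D)). \<forall>i\<in>I. x < y i} = PiE I (\<lambda>_. {x<..})"
    using sets_eq_imp_space_eq[OF assms(2)] by (fastforce simp: space_PiM PiE_iff extensional_def)
  then show ?thesis
    using assms by (simp add: emeasure_PiM)
qed

text \<open>Integrate coordinate \<open>i\<close> last: given its value \<open>x\<close>, the event
  asks each of the other \<open>card I - 1\<close> independent coordinates to be at least
  \<open>x\<close>.\<close>

lemma nn_integral_PiM_if_le_all:
  fixes D :: "real measure" and h :: "real \<Rightarrow> ennreal"
  assumes "prob_space D" and [measurable_cong]: "sets D = sets borel"
    and I: "finite I" "i \<in> I" and [measurable]: "h \<in> borel_measurable borel"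
  shows "(\<integral>\<^sup>+y. (if \<forall>i'\<in>I. y i \<le> y i' then h (y i) else 0) \<partial>PiM I (\<lambda>_. D))
    = (\<integral>\<^sup>+x. h x * emeasure D {x..} ^ (card I - 1) \<partial>D)"
proof -
  interpret D: prob_space D by fact
  interpret product_sigma_finite "\<lambda>_. D" ..
  define J where "J = I - {i}"
  have J: "finite J" "i \<notin> J" "I = insert i J" "card J = card I - 1"
    using I by (auto simp: J_def)
  have fin: "finite (insert i J)" using J by simp
  have comp: "(\<lambda>y. y k) \<in> borel_measurable (PiM (insert i J) (\<lambda>_. D))" if "k \<in> insert i J" for k
    using measurable_component_singleton[OF that, of "\<lambda>_. D"] assms(2) by (simp cong: measurable_cong_sets)
  let ?f = "\<lambda>y. if \<forall>i'\<in>I. y i \<le> y i' then h (y i) else (0::ennreal)"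
  have meas: "?f \<in> borel_measurable (PiM (insert i J) (\<lambda>_. D))"
    unfolding J(3)
    using J fin by (intro measurable_If sets.sets_Collect_finite_All' borel_measurable_le measurable_compose[OF comp] comp) auto
  have "(\<integral>\<^sup>+y. ?f y \<partial>PiM (insert i J) (\<lambda>_. D))
    = (\<integral>\<^sup>+x. (\<integral>\<^sup>+y. ?f (y(i := x)) \<partial>PiM J (\<lambda>_. D)) \<partial>D)"
    by (rule product_nn_integral_insert_rev[OF J(1,2) meas])
  also have "\<dots> = (\<integral>\<^sup>+x. (\<integral>\<^sup>+y. h x * (\<Prod>i'\<in>J. indicator {x..} (y i')) \<partial>PiM J (\<lambda>_. D)) \<partial>D)"
  proof (intro nn_integral_cong)
    fix x and y :: "_ \<Rightarrow> real"
    show "?f (y(i := x)) = h x * (\<Prod>i'\<in>J. indicator {x..} (y i'))"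
    proof (cases "\<forall>i'\<in>J. x \<le> y i'")
      case True
      then have "(\<Prod>i'\<in>J. indicator {x..} (y i')) = (1::ennreal)" by (intro prod.neutral) auto
      with True J show ?thesis by auto
    next
      case False
      then have "(\<Prod>i'\<in>J. indicator {x..} (y i')) = (0::ennreal)"
        using J by (intro prod_zero) (auto simp: indicator_def)
      with False J show ?thesis by auto
    qed
  qed
  also have "\<dots> = (\<integral>\<^sup>+x. h x * emeasure D {x..} ^ (card I - 1) \<partial>D)"
  proof (intro nn_integral_cong)
    fix x :: real
    have "(\<integral>\<^sup>+y. h x * (\<Prod>i'\<in>J. indicator {x..} (y i')) \<partial>PiM J (\<lambda>_. D))
        = h x * (\<integral>\<^sup>+y. (\<Prod>i'\<in>J. indicator {x..} (y i')) \<partial>PiM J (\<lambda>_. D))"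
      by (rule nn_integral_cmult) measurable
    also have "\<dots> = h x * emeasure D {x..} ^ (card I - 1)"
      using J(1,4) assms(2) by (subst product_nn_integral_prod) auto
    finally show "(\<integral>\<^sup>+y. h x * (\<Prod>i'\<in>J. indicator {x..} (y i')) \<partial>PiM J (\<lambda>_. D))
        = h x * emeasure D {x..} ^ (card I - 1)" .
  qed
  finally show ?thesis by (simp only: J(3)[symmetric])
qed

text \<open>Independence over all pairs is restricted to column \<open>j\<close> by grouping the
  pairs into the singletons \<open>{(i, j)}\<close>; an independent family has a product as joint
  law.\<close>

lemma (in prob_space) distr_indep_vars_column:
  fixes t :: "'i \<Rightarrow> 'j \<Rightarrow> 'a \<Rightarrow> real"
  assumes indep: "indep_vars (\<lambda>_. borel) (\<lambda>(i, j). t i j) (I \<times> J)"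
    and law: "\<And>i j. i \<in> I \<Longrightarrow> j \<in> J \<Longrightarrow> distr M borel (t i j) = D"
    and j: "j \<in> J" and "I \<noteq> {}"
  shows "distr M (PiM I (\<lambda>_. borel)) (\<lambda>\<omega>. \<lambda>i\<in>I. t i j \<omega>) = PiM I (\<lambda>_. D)"
proof -
  have "indep_vars (\<lambda>i. PiM {(i, j)} (\<lambda>_. borel))
      (\<lambda>i \<omega>. restrict (\<lambda>i. (case i of (i, j) \<Rightarrow> t i j) \<omega>) {(i, j)}) I"
    using j by (intro indep_vars_restrict[OF indep]) (auto simp: disjoint_family_on_def)
  from indep_vars_compose2[OF this, where Y = "\<lambda>i v. v (i, j)" and N = "\<lambda>_. borel"]
  have "indep_vars (\<lambda>_. borel) (\<lambda>i. t i j) I"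
    by simp
  moreover have "random_variable borel (t i j)" if "i \<in> I" for i
    using indep that j by (auto simp: indep_vars_def)
  ultimately have "distr M (PiM I (\<lambda>_. borel)) (\<lambda>\<omega>. \<lambda>i\<in>I. t i j \<omega>) = PiM I (\<lambda>i. distr M borel (t i j))"
    using \<open>I \<noteq> {}\<close> by (subst (asm) indep_vars_iff_distr_eq_PiM') auto
  also have "\<dots> = PiM I (\<lambda>_. D)"
    using j law by (intro PiM_cong) auto
  finally show ?thesis .
qed

text \<open>Distinct columns are disjoint blocks of an independent family, so functions of them are
  independent and the integral of the product factorises. All columns share one law, which makes the
  factors equal.\<close>

lemma (in prob_space) nn_integral_prod_indep_columns:
  fixes t :: "'i \<Rightarrow> 'j \<Rightarrow> 'a \<Rightarrow> real" and f :: "('i \<Rightarrow> real) \<Rightarrow> ennreal"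
  assumes indep: "indep_vars (\<lambda>_. borel) (\<lambda>(i, j). t i j) (I \<times> J)"
    and law: "\<And>i j. i \<in> I \<Longrightarrow> j \<in> J \<Longrightarrow> distr M borel (t i j) = D"
    and "finite J" "I \<noteq> {}" and f[measurable]: "f \<in> borel_measurable (PiM I (\<lambda>_. borel))"
  shows "(\<integral>\<^sup>+\<omega>. (\<Prod>j\<in>J. f (\<lambda>i\<in>I. t i j \<omega>)) \<partial>M) = (\<integral>\<^sup>+y. f y \<partial>PiM I (\<lambda>_. D)) ^ card J"
proof -
  have rv: "random_variable borel (t i j)" if "i \<in> I" "j \<in> J" for i j
    using indep that by (auto simp: indep_vars_def)
  have "indep_vars (\<lambda>j. PiM (I \<times> {j}) (\<lambda>_. borel))
      (\<lambda>j \<omega>. restrict (\<lambda>i. (case i of (i, j) \<Rightarrow> t i j) \<omega>) (I \<times> {j})) J"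
    by (rule indep_vars_restrict[OF indep]) (auto simp: disjoint_family_on_def)
  then have "indep_vars (\<lambda>_. borel)
      (\<lambda>j \<omega>. f (\<lambda>i\<in>I. restrict (\<lambda>i. (case i of (i, j) \<Rightarrow> t i j) \<omega>) (I \<times> {j}) (i, j))) J"
  proof (rule indep_vars_compose2[where Y = "\<lambda>j v. f (\<lambda>i\<in>I. v (i, j))"])
    fix j
    show "(\<lambda>v. f (\<lambda>i\<in>I. v (i, j))) \<in> borel_measurable (PiM (I \<times> {j}) (\<lambda>_. borel))"
      by (rule measurable_compose[OF measurable_restrict f]) measurable
  qed
  moreover have "(\<lambda>i\<in>I. restrict (\<lambda>i. (case i of (i, j) \<Rightarrow> t i j) \<omega>) (I \<times> {j}) (i, j)) = (\<lambda>i\<in>I. t i j \<omega>)"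
    for j \<omega> by auto
  ultimately have "indep_vars (\<lambda>_. borel) (\<lambda>j \<omega>. f (\<lambda>i\<in>I. t i j \<omega>)) J"
    by simp
  then have "(\<integral>\<^sup>+\<omega>. (\<Prod>j\<in>J. f (\<lambda>i\<in>I. t i j \<omega>)) \<partial>M) = (\<Prod>j\<in>J. \<integral>\<^sup>+\<omega>. f (\<lambda>i\<in>I. t i j \<omega>) \<partial>M)"
    using \<open>finite J\<close> by (intro indep_vars_nn_integral) auto
  also have "\<dots> = (\<Prod>j\<in>J. \<integral>\<^sup>+y. f y \<partial>PiM I (\<lambda>_. D))"
  proof (intro prod.cong refl)
    fix j assume j: "j \<in> J"
    have "(\<integral>\<^sup>+\<omega>. f (\<lambda>i\<in>I. t i j \<omega>) \<partial>M)
        = (\<integral>\<^sup>+y. f y \<partial>distr M (PiM I (\<lambda>_. borel)) (\<lambda>\<omega>. \<lambda>i\<in>I. t i j \<omega>))"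
      using rv j by (subst nn_integral_distr) (auto intro!: measurable_restrict)
    then show "(\<integral>\<^sup>+\<omega>. f (\<lambda>i\<in>I. t i j \<omega>) \<partial>M) = (\<integral>\<^sup>+y. f y \<partial>PiM I (\<lambda>_. D))"
      by (simp add: distr_indep_vars_column[OF indep law j \<open>I \<noteq> {}\<close>])
  qed
  finally show ?thesis by simp
qed

section \<open>The factor 4 for a general law of the processing times\<close>

text \<open>The law enters through its tail \<open>S\<close> and three integrals.
  \<open>mean_min\<close> bounds the mean of a column minimum below by \<open>\<mu>\<close>, and
  \<open>mean_max_min\<close> bounds the mean of the maximum of the \<open>m\<close> minima below by
  \<open>\<mu> * ln n\<close>. \<open>mgf\<close> is the share of one machine: by symmetry,
  \<open>n\<close> such shares make the exponential moment of a minimum at most 2.\<close>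

lemma expected_VCG_le_4_OPT_of_iid:
  fixes M :: "'a measure" and t :: "nat \<Rightarrow> nat \<Rightarrow> 'a \<Rightarrow> real" and n m :: nat
    and D :: "real measure" and S :: "real \<Rightarrow> real" and \<mu> :: real
  assumes "prob_space M" and n: "1 \<le> n" "n \<le> m"
    and indep: "prob_space.indep_vars M (\<lambda>_. borel) (\<lambda>(i, j). t i j) ({1..n} \<times> {1..m})"
    and law: "\<And>i j. i \<in> {1..n} \<Longrightarrow> j \<in> {1..m} \<Longrightarrow> distr M borel (t i j) = D"
    and D_nonneg: "AE x in D. 0 \<le> x"
    and D_integrable: "integrable D (\<lambda>x. x)"
    and S: "\<And>x. 0 \<le> x \<Longrightarrow> 0 \<le> S x" "\<And>x. 0 \<le> x \<Longrightarrow> S x \<le> 1"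
    and D_tail: "\<And>x. 0 \<le> x \<Longrightarrow> emeasure D {x<..} = ennreal (S x)"
      "\<And>x. 0 \<le> x \<Longrightarrow> emeasure D {x..} = ennreal (S x)"
    and "0 < \<mu>"
    and mean_min: "ennreal \<mu> \<le> (\<integral>\<^sup>+x\<in>{0..}. ennreal (S x ^ n) \<partial>lborel)"
    and mean_max_min: "ennreal (\<mu> * ln n) \<le> (\<integral>\<^sup>+x\<in>{0..}. ennreal (1 - (1 - S x ^ n) ^ m) \<partial>lborel)"
    and mgf: "(\<integral>\<^sup>+x. ennreal ((exp (x / (2 * \<mu>)) - 1) * S x ^ (n - 1)) \<partial>D) \<le> ennreal (1 / n)"
  shows "prob_space.expectation M (\<lambda>\<omega>. expected_VCG n m (\<lambda>i j. t i j \<omega>))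
    \<le> 4 * prob_space.expectation M (\<lambda>\<omega>. OPT n m (\<lambda>i j. t i j \<omega>))"
proof -
  interpret prob_space M by fact
  have rv[measurable]: "t i j \<in> borel_measurable M" if "i \<in> {1..n}" "j \<in> {1..m}" for i j
    using indep that by (auto simp: indep_vars_def)
  have D_eq: "D = distr M borel (t 1 1)" using law[of 1 1] n by simp
  have D_prob: "prob_space D"
    unfolding D_eq using n by (intro prob_space_distr rv) auto
  have D_sets[measurable_cong]: "sets D = sets borel" by (simp add: D_eq)
  have nonempty: "{1..n} \<noteq> {}" "{1..m} \<noteq> {}" using n by auto
  define P where "P = PiM {1..n} (\<lambda>_. D)"
  interpret P: prob_space P unfolding P_def by (rule prob_space_PiM) (rule D_prob)
  have P_sets[measurable_cong]: "sets P = sets (PiM {1..n} (\<lambda>_. borel))"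
    unfolding P_def by (intro sets_PiM_cong refl D_sets)
  have P_space: "space P = {1..n} \<rightarrow>\<^sub>E UNIV"
    using sets_eq_imp_space_eq[OF P_sets] by (simp add: space_PiM)
  have P_all_gt: "emeasure P {y \<in> space P. \<forall>i\<in>{1..n}. x < y i} = ennreal (S x ^ n)" if "0 \<le> x" for x
    using emeasure_PiM_all_gt[OF D_prob D_sets, of "{1..n}" x] D_tail(1)[OF that] S(1)[OF that]
    by (simp add: P_def ennreal_power)
  have column_prod: "(\<integral>\<^sup>+\<omega>. (\<Prod>j\<in>J. f (\<lambda>i\<in>{1..n}. t i j \<omega>)) \<partial>M) = (\<integral>\<^sup>+y. f y \<partial>P) ^ card J"
    if "f \<in> borel_measurable (PiM {1..n} (\<lambda>_. borel))" "J \<subseteq> {1..m}" for J f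
    unfolding P_def using that nonempty
    by (intro nn_integral_prod_indep_columns[OF indep_vars_subset[OF indep] law])
       (auto intro: finite_subset)

  have AE_nonneg: "AE \<omega> in M. \<forall>i\<in>{1..n}. \<forall>j\<in>{1..m}. 0 \<le> t i j \<omega>"
  proof (intro AE_finite_allI)
    fix i j assume ij: "i \<in> {1..n}" "j \<in> {1..m}"
    show "AE \<omega> in M. 0 \<le> t i j \<omega>"
      by (rule AE_distrD[OF rv[OF ij], unfolded law[OF ij], OF D_nonneg])
  qed auto
  have int_t: "integrable M (t i j)" if "i \<in> {1..n}" "j \<in> {1..m}" for i j
    by (rule integrable_distr[OF rv[OF that], unfolded law[OF that], OF D_integrable])
  have int_OPT: "integrable M (\<lambda>\<omega>. OPT n m (\<lambda>i j. t i j \<omega>))"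
    unfolding OPT_def makespan_def using nonempty
    by (intro integrable_MIN integrable_MAX Bochner_Integration.integrable_sum int_t)
       (auto simp: finite_PiE PiE_eq_empty_iff)

  define X where "X j \<omega> = (MIN i\<in>{1..n}. t i j \<omega>)" for j \<omega>
  have int_X: "integrable M (X j)" if "j \<in> {1..m}" for j
    unfolding X_def using that nonempty by (intro integrable_MIN int_t) auto
  define Z where "Z \<omega> = (MAX j\<in>{1..m}. X j \<omega>)" for \<omega>
  have int_Z: "integrable M Z"
    unfolding Z_def using nonempty by (intro integrable_MAX int_X) auto
  note [measurable] = borel_measurable_integrable[OF int_Z]
  have X_nonneg: "AE \<omega> in M. \<forall>j\<in>{1..m}. 0 \<le> X j \<omega>"
    using AE_nonneg by eventually_elim (use nonempty in \<open>auto simp: X_def\<close>)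
  have Z_nonneg: "AE \<omega> in M. 0 \<le> Z \<omega>"
    using X_nonneg by eventually_elim (use n in \<open>auto simp: Z_def Max_ge_iff intro!: bexI[of _ 1]\<close>)
  define opt where "opt = expectation (\<lambda>\<omega>. OPT n m (\<lambda>i j. t i j \<omega>))"

  have mean_X: "\<mu> \<le> expectation (X j)" if j: "j \<in> {1..m}" for j
  proof -
    \<comment> \<open>The product over the one-element set \<open>{j}\<close> makes
      \<open>column_prod\<close> applicable, which replaces the column by a sample from
      \<open>P\<close>.\<close>
    have "(\<integral>\<^sup>+\<omega>. ennreal (X j \<omega>) \<partial>M)
        = (\<integral>\<^sup>+\<omega>. (\<Prod>j\<in>{j}. ennreal (MIN i\<in>{1..n}. (\<lambda>i\<in>{1..n}. t i j \<omega>) i)) \<partial>M)"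
      by (simp add: X_def cong: INF_cong image_cong_simp)
    also have "\<dots> = (\<integral>\<^sup>+y. ennreal (MIN i\<in>{1..n}. y i) \<partial>P)"
      using j by (subst column_prod) auto
    also have "\<dots> = (\<integral>\<^sup>+x\<in>{0..}. emeasure P {y \<in> space P. x < (MIN i\<in>{1..n}. y i)} \<partial>lborel)"
      by (rule P.nn_integral_eq_tail) measurable
    also have "\<dots> = (\<integral>\<^sup>+x\<in>{0..}. ennreal (S x ^ n) \<partial>lborel)"
      using P_all_gt nonempty by (intro nn_integral_cong) (auto simp: Min_gr_iff split: split_indicator)
    finally have "ennreal \<mu> \<le> (\<integral>\<^sup>+\<omega>. ennreal (X j \<omega>) \<partial>M)"
      using mean_min by simp
    also have "\<dots> = ennreal (expectation (X j))"
      using X_nonneg j by (intro nn_integral_eq_integral int_X) auto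
    finally show ?thesis
      using X_nonneg j by (subst (asm) ennreal_le_iff) (auto intro!: integral_nonneg_AE)
  qed
  have "m * \<mu> \<le> (\<Sum>j\<in>{1..m}. expectation (X j))"
    using sum_mono[of "{1..m}" "\<lambda>_. \<mu>", OF mean_X] by simp
  also have "\<dots> = expectation (\<lambda>\<omega>. \<Sum>j\<in>{1..m}. X j \<omega>)"
    by (intro Bochner_Integration.integral_sum[symmetric] int_X)
  also have "\<dots> \<le> expectation (\<lambda>\<omega>. n * OPT n m (\<lambda>i j. t i j \<omega>))"
    using n sum_min_time_le_OPT[of n]
    by (intro integral_mono Bochner_Integration.integrable_sum int_X integrable_mult_right int_OPT)
       (auto simp: X_def)
  finally have opt1: "m * \<mu> / n \<le> opt"
    using n by (simp add: opt_def field_simps)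

  \<comment> \<open>Pass to the complement: \<open>Z \<omega> \<le> x\<close> says that every column
    misses \<open>A\<close>, the event that all its entries exceed \<open>x\<close>. This is a
    product over independent columns.\<close>
  have tail_Z: "emeasure M {\<omega> \<in> space M. x < Z \<omega>} = ennreal (1 - (1 - S x ^ n) ^ m)" if x: "0 \<le> x" for x
  proof -
    define A where "A = {y \<in> space P. \<forall>i\<in>{1..n}. x < y i}"
    have A[measurable]: "A \<in> sets P" unfolding A_def by measurable
    have "{\<omega> \<in> space M. Z \<omega> \<le> x} \<in> sets M"
      by measurable
    then have "emeasure M {\<omega> \<in> space M. Z \<omega> \<le> x} = (\<integral>\<^sup>+\<omega>. indicator {\<omega> \<in> space M. Z \<omega> \<le> x} \<omega> \<partial>M)"
      by simp
    also have "\<dots> = (\<integral>\<^sup>+\<omega>. (\<Prod>j\<in>{1..m}. indicator (space P - A) (\<lambda>i\<in>{1..n}. t i j \<omega>)) \<partial>M)"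
    proof (intro nn_integral_cong)
      fix \<omega> assume "\<omega> \<in> space M"
      have mem: "(\<lambda>i\<in>{1..n}. t i j \<omega>) \<in> space P - A \<longleftrightarrow> X j \<omega> \<le> x" for j
        using nonempty by (auto simp: A_def P_space X_def Min_le_iff not_less)
      have "Z \<omega> \<le> x \<longleftrightarrow> (\<forall>j\<in>{1..m}. X j \<omega> \<le> x)"
        using nonempty by (simp add: Z_def)
      then show "indicator {\<omega> \<in> space M. Z \<omega> \<le> x} \<omega>
          = (\<Prod>j\<in>{1..m}. indicator (space P - A) (\<lambda>i\<in>{1..n}. t i j \<omega>) :: ennreal)"
        using \<open>\<omega> \<in> space M\<close> mem
        by (cases "Z \<omega> \<le> x") (auto simp: indicator_def intro!: prod.neutral prod_zero)
    qed
    also have "\<dots> = (\<integral>\<^sup>+y. indicator (space P - A) y \<partial>P) ^ m"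
      using sets.compl_sets[OF A, unfolded P_sets]
      by (subst column_prod[OF borel_measurable_indicator]) auto
    also have "(\<integral>\<^sup>+y. indicator (space P - A) y \<partial>P) = emeasure P (space P - A)"
      by simp
    also have "\<dots> = 1 - ennreal (S x ^ n)"
      using P_all_gt[OF x] A by (subst emeasure_compl) (auto simp: P.emeasure_space_1 A_def)
    also have "\<dots> = ennreal (1 - S x ^ n)"
      using S(1)[OF x] by (simp add: ennreal_minus flip: ennreal_1)
    also have "\<dots> ^ m = ennreal ((1 - S x ^ n) ^ m)"
      using S[OF x] by (simp add: ennreal_power power_le_one)
    finally have "emeasure M {\<omega> \<in> space M. Z \<omega> \<le> x} = ennreal ((1 - S x ^ n) ^ m)" .
    moreover have "{\<omega> \<in> space M. x < Z \<omega>} = space M - {\<omega> \<in> space M. Z \<omega> \<le> x}" by auto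
    moreover have "0 \<le> (1 - S x ^ n) ^ m"
      using S[OF x] by (simp add: power_le_one)
    ultimately show ?thesis
      using \<open>{\<omega> \<in> space M. Z \<omega> \<le> x} \<in> sets M\<close>
      by (simp add: emeasure_compl emeasure_space_1 ennreal_minus flip: ennreal_1)
  qed
  have "ennreal (\<mu> * ln n) \<le> (\<integral>\<^sup>+x\<in>{0..}. emeasure M {\<omega> \<in> space M. x < Z \<omega>} \<partial>lborel)"
    by (rule order_trans[OF mean_max_min], intro nn_integral_mono) (auto simp: tail_Z split: split_indicator)
  also have "\<dots> = (\<integral>\<^sup>+\<omega>. ennreal (Z \<omega>) \<partial>M)"
    by (intro nn_integral_eq_tail[symmetric]) measurable
  also have "\<dots> = ennreal (expectation Z)"
    by (intro nn_integral_eq_integral int_Z Z_nonneg)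
  finally have "\<mu> * ln n \<le> expectation Z"
    using Z_nonneg by (subst (asm) ennreal_le_iff) (auto intro!: integral_nonneg_AE)
  also have "\<dots> \<le> opt"
    unfolding opt_def
  proof (intro integral_mono_AE int_Z int_OPT)
    show "AE \<omega> in M. Z \<omega> \<le> OPT n m (\<lambda>i j. t i j \<omega>)"
      using AE_nonneg
    proof eventually_elim
      case (elim \<omega>)
      then have "X j \<omega> \<le> OPT n m (\<lambda>i j. t i j \<omega>)" if "j \<in> {1..m}" for j
        unfolding X_def using n that by (intro min_time_le_OPT) auto
      then show ?case
        unfolding Z_def using nonempty by (intro Max.boundedI) auto
    qed
  qed
  finally have opt2: "\<mu> * ln n \<le> opt" .

  \<comment> \<open>The exponent \<open>1 / (2 * \<mu>)\<close> makes the \<open>j\<close>-th factor of \<open>E (exp (\<theta> * L i))\<close> at most \<open>1 + 1 / n\<close>.\<close>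
  define \<theta> where "\<theta> = 1 / (2 * \<mu>)"
  have \<theta>: "0 < \<theta>" using \<open>0 < \<mu>\<close> by (simp add: \<theta>_def)
  define L where "L i \<omega> = fastest_load n m (\<lambda>i j. t i j \<omega>) i" for i \<omega>
  define W where "W \<omega> = (MAX i\<in>{1..n}. L i \<omega>)" for \<omega>
  have int_L: "integrable M (L i)" if i: "i \<in> {1..n}" for i
    unfolding L_def fastest_load_def
  proof (intro Bochner_Integration.integrable_sum)
    fix j assume j: "j \<in> {1..m}"
    have "{\<omega> \<in> space M. \<forall>i'\<in>{1..n}. t i j \<omega> \<le> t i' j \<omega>} \<in> sets M"
      using i j rv by (intro sets.sets_Collect_finite_All' borel_measurable_le) (use nonempty in auto)
    then show "integrable M (\<lambda>\<omega>. if \<forall>i'\<in>{1..n}. t i j \<omega> \<le> t i' j \<omega> then t i j \<omega> else 0)"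
      using i j rv by (intro Bochner_Integration.integrable_bound[OF int_t[OF i j]] measurable_If) auto
  qed
  have int_W: "integrable M W"
    unfolding W_def using nonempty by (intro integrable_MAX int_L) auto
  have mgf_L: "(\<integral>\<^sup>+\<omega>. ennreal (exp (\<theta> * L i \<omega>)) \<partial>M) \<le> ennreal (exp (m / n))" if i: "i \<in> {1..n}" for i
  proof -
    \<comment> \<open>\<open>f\<close> is the factor of one column in
      \<open>exp (\<theta> * L i)\<close>. It equals 1 when machine \<open>i\<close> is not fastest,
      so only the excess \<open>g\<close> over 1 on the event that it is fastest has to be
      integrated.\<close>
    define f where "f y = ennreal (exp (\<theta> * (if \<forall>i'\<in>{1..n}. y i \<le> y i' then y i else 0)))" for y :: "nat \<Rightarrow> real"
    define g where "g y = (if \<forall>i'\<in>{1..n}. y i \<le> y i' then ennreal (exp (\<theta> * y i) - 1) else 0)" for y :: "nat \<Rightarrow> real"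
    have fast: "{y \<in> space (PiM {1..n} (\<lambda>_. borel)). \<forall>i'\<in>{1..n}. y i \<le> (y i' :: real)} \<in> sets (PiM {1..n} (\<lambda>_. borel))"
      using i by (intro sets.sets_Collect_finite_All' borel_measurable_le measurable_component_singleton) auto
    have comp: "(\<lambda>y. y i) \<in> borel_measurable (PiM {1..n} (\<lambda>_. borel :: real measure))"
      using i by (rule measurable_component_singleton)
    have f: "f \<in> borel_measurable (PiM {1..n} (\<lambda>_. borel))"
      unfolding f_def using fast comp
      by (intro measurable_compose[OF _ measurable_ennreal] measurable_compose[OF _ borel_measurable_exp] borel_measurable_times
          borel_measurable_const measurable_If)
    have g: "g \<in> borel_measurable P"
      unfolding g_def measurable_cong_sets[OF P_sets refl] using fast comp
      by (intro measurable_If measurable_compose[OF _ measurable_ennreal] borel_measurable_diff measurable_compose[OF _ borel_measurable_exp] borel_measurable_times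
          borel_measurable_const)
    have f_column: "f (\<lambda>i\<in>{1..n}. t i j \<omega>)
        = ennreal (exp (\<theta> * (if \<forall>i'\<in>{1..n}. t i j \<omega> \<le> t i' j \<omega> then t i j \<omega> else 0)))" for j \<omega>
      using i by (auto simp: f_def)
    have "(\<integral>\<^sup>+y. f y \<partial>P) \<le> (\<integral>\<^sup>+y. 1 + g y \<partial>P)"
    proof (intro nn_integral_mono)
      fix y
      \<comment> \<open>For negative \<open>a\<close> the right-hand side is 1, because
        \<open>ennreal\<close> sends the negative excess to 0; hence an inequality.\<close>
      have "ennreal (exp a) \<le> 1 + ennreal (exp a - 1)" for a :: real
        by (cases "0 \<le> a") (simp_all flip: ennreal_1 ennreal_plus, simp add: ennreal_neg)
      then show "f y \<le> 1 + g y" by (simp add: f_def g_def)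
    qed
    also have "\<dots> = 1 + (\<integral>\<^sup>+y. g y \<partial>P)"
      using g by (subst nn_integral_add) (auto simp: P.emeasure_space_1)
    also have "(\<integral>\<^sup>+y. g y \<partial>P) = (\<integral>\<^sup>+x. ennreal (exp (\<theta> * x) - 1) * emeasure D {x..} ^ (n - 1) \<partial>D)"
      unfolding g_def P_def using i by (subst nn_integral_PiM_if_le_all[OF D_prob D_sets]) auto
    also have "\<dots> = (\<integral>\<^sup>+x. ennreal ((exp (x / (2 * \<mu>)) - 1) * S x ^ (n - 1)) \<partial>D)"
    proof (rule nn_integral_cong_AE)
      show "AE x in D. ennreal (exp (\<theta> * x) - 1) * emeasure D {x..} ^ (n - 1)
          = ennreal ((exp (x / (2 * \<mu>)) - 1) * S x ^ (n - 1))"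
        using D_nonneg
      proof eventually_elim
        case (elim x)
        then show ?case
          using D_tail(2)[OF elim] S(1)[OF elim] \<open>0 < \<mu>\<close>
          by (simp add: \<theta>_def ennreal_power ennreal_mult)
      qed
    qed
    also have "1 + \<dots> \<le> 1 + ennreal (1 / n)"
      by (intro add_left_mono mgf)
    also have "\<dots> = ennreal (1 + 1 / n)" by (simp flip: ennreal_1 ennreal_plus)
    also have "\<dots> \<le> ennreal (exp (1 / n))"
      by (intro ennreal_leI exp_ge_add_one_self)
    finally have f_mean: "(\<integral>\<^sup>+y. f y \<partial>P) \<le> ennreal (exp (1 / n))" .
    have "(\<integral>\<^sup>+\<omega>. ennreal (exp (\<theta> * L i \<omega>)) \<partial>M) = (\<integral>\<^sup>+\<omega>. (\<Prod>j\<in>{1..m}. f (\<lambda>i\<in>{1..n}. t i j \<omega>)) \<partial>M)"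
      unfolding f_column
      by (simp add: L_def fastest_load_def sum_distrib_left exp_sum prod_ennreal)
    also have "\<dots> = (\<integral>\<^sup>+y. f y \<partial>P) ^ m"
      using f by (subst column_prod) auto
    also have "\<dots> \<le> ennreal (exp (1 / n)) ^ m"
      by (intro power_mono f_mean) simp
    also have "\<dots> = ennreal (exp (m / n))"
      by (simp add: ennreal_power flip: exp_of_nat_mult)
    finally show ?thesis .
  qed
  \<comment> \<open>\<open>K\<close> is the sum of the \<open>n\<close> bounds from
    \<open>mgf_L\<close>; it bounds the exponential moment of the maximum load
    \<open>W\<close>.\<close>
  define K where "K = n * exp (m / n)"
  have K: "0 < K" using n by (simp add: K_def)
  have lnK: "ln K = ln n + m / n" using n by (simp add: K_def ln_mult)
  note [measurable] = borel_measurable_integrable[OF int_L] borel_measurable_integrable[OF int_W]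
  have "(\<integral>\<^sup>+\<omega>. ennreal (exp (\<theta> * W \<omega>)) \<partial>M) \<le> (\<integral>\<^sup>+\<omega>. (\<Sum>i\<in>{1..n}. ennreal (exp (\<theta> * L i \<omega>))) \<partial>M)"
  proof (intro nn_integral_mono)
    fix \<omega>
    have "W \<omega> \<in> (\<lambda>i. L i \<omega>) ` {1..n}"
      unfolding W_def using nonempty by (intro Max_in) auto
    then obtain i where "i \<in> {1..n}" "W \<omega> = L i \<omega>" by auto
    then show "ennreal (exp (\<theta> * W \<omega>)) \<le> (\<Sum>i\<in>{1..n}. ennreal (exp (\<theta> * L i \<omega>)))"
      using member_le_sum[of i "{1..n}" "\<lambda>i. ennreal (exp (\<theta> * L i \<omega>))"] by simp
  qed
  also have "\<dots> = (\<Sum>i\<in>{1..n}. \<integral>\<^sup>+\<omega>. ennreal (exp (\<theta> * L i \<omega>)) \<partial>M)"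
    by (intro nn_integral_sum) measurable
  also have "\<dots> \<le> (\<Sum>i\<in>{1..n}. ennreal (exp (m / n)))"
    by (intro sum_mono mgf_L)
  also have "\<dots> = ennreal K"
    by (simp add: K_def ennreal_mult ennreal_of_nat_eq_real_of_nat)
  finally have nn_W: "(\<integral>\<^sup>+\<omega>. ennreal (exp (\<theta> * W \<omega>)) \<partial>M) \<le> ennreal K" .
  then have int_exp_W: "integrable M (\<lambda>\<omega>. exp (\<theta> * W \<omega>))"
    by (intro integrableI_nonneg) (auto simp: less_top[symmetric] top_unique)
  have exp_W: "expectation (\<lambda>\<omega>. exp (\<theta> * W \<omega>)) \<le> K"
    using K nn_W by (intro integral_real_bounded) auto
  \<comment> \<open>This is Jensen's inequality for \<open>ln\<close>, obtained from the tangent at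
    \<open>K\<close>: \<open>ln y \<le> ln K - 1 + y / K\<close>, applied to
    \<open>y = exp (\<theta> * W \<omega>)\<close> and integrated.\<close>
  have "\<theta> * expectation W = expectation (\<lambda>\<omega>. \<theta> * W \<omega>)" by simp
  also have "\<dots> \<le> expectation (\<lambda>\<omega>. ln K - 1 + exp (\<theta> * W \<omega>) / K)"
  proof (intro integral_mono Bochner_Integration.integrable_add integrable_mult_right int_W
      integrable_divide int_exp_W integrable_const)
    fix \<omega>
    have "ln (exp (\<theta> * W \<omega>) / K) \<le> exp (\<theta> * W \<omega>) / K - 1"
      using K by (intro ln_le_minus_one) auto
    then show "\<theta> * W \<omega> \<le> ln K - 1 + exp (\<theta> * W \<omega>) / K"
      using K by (simp add: ln_div)
  qed
  also have "\<dots> = ln K - 1 + expectation (\<lambda>\<omega>. exp (\<theta> * W \<omega>)) / K"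
    using int_exp_W by (simp add: prob_space)
  also have "\<dots> \<le> ln K"
    using exp_W K by (simp add: field_simps)
  \<comment> \<open>Dividing by \<open>\<theta>\<close> gives the factor \<open>2 * \<mu>\<close> in
    front of \<open>ln n + m / n\<close>. Each of the two summands costs \<open>2 * opt\<close>,
    whence the constant 4.\<close>
  finally have "expectation W \<le> 2 * (\<mu> * ln n) + 2 * (m * \<mu> / n)"
    using \<open>0 < \<mu>\<close> by (simp add: lnK \<theta>_def field_simps)
  then have W_le: "expectation W \<le> 4 * opt"
    using opt1 opt2 by linarith

  \<comment> \<open>A non-integrable function has expectation 0, so measurability of \<open>expected_VCG\<close> is not needed.\<close>
  show ?thesis
  proof (cases "integrable M (\<lambda>\<omega>. expected_VCG n m (\<lambda>i j. t i j \<omega>))")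
    case True
    have "expectation (\<lambda>\<omega>. expected_VCG n m (\<lambda>i j. t i j \<omega>)) \<le> expectation W"
    proof (intro integral_mono_AE True int_W)
      show "AE \<omega> in M. expected_VCG n m (\<lambda>i j. t i j \<omega>) \<le> W \<omega>"
        using AE_nonneg
      proof eventually_elim
        case (elim \<omega>)
        then show ?case
          unfolding W_def L_def using n by (intro expected_VCG_le_max_fastest_load) auto
      qed
    qed
    with W_le show ?thesis by (simp add: opt_def)
  next
    case False
    have "0 \<le> m * \<mu> / n" using \<open>0 < \<mu>\<close> by simp
    with opt1 have "0 \<le> opt" by linarith
    with False show ?thesis by (simp add: opt_def not_integrable_integral_eq)
  qed
qed

section \<open>Logarithmic and integral estimates for the uniform law\<close>

text \<open>\<open>harm n - 1 / 2 - 1 / (2 * n)\<close> is the trapezoidal sum of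
  \<open>1 / x\<close> on [1, n], which is at least the integral by convexity. The induction step is
  the estimate for one interval.\<close>

lemma harm_ge_ln_plus_half:
  assumes "n \<ge> 1"
  shows "ln (real n) + 1 / 2 + 1 / (2 * real n) \<le> harm n"
  using assms
proof (induction n rule: dec_induct)
  case base
  then show ?case by (simp add: harm_expand)
next
  case (step k)
  have "ln (real k + 1) - ln (real k) \<le> 1 * (inverse (real k) + inverse (real k + 1)) / 2"
    using step by (intro ln_inverse_approx_le) auto
  moreover have "1 / (2 * real k) = inverse (real k) / 2"
    "1 / (2 * real (Suc k)) = inverse (real k + 1) / 2" by (simp_all add: field_simps)
  moreover have "harm (Suc k) = harm k + inverse (real k + 1)"
    by (simp add: harm_Suc add.commute)
  ultimately show ?case
    using step.IH by (simp add: add.commute)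
qed

text \<open>In terms of \<open>L = ln x\<close>, replacing \<open>x = exp L\<close> by its Taylor
  polynomial of degree 4 leaves a quartic inequality for nonnegative \<open>L\<close>.\<close>

lemma ln_squared_le:
  assumes "x \<ge> (1::real)"
  shows "2 * (ln x)\<^sup>2 \<le> x + 1 + ln x"
proof -
  define L where "L = ln x"
  have L: "L \<ge> 0" "exp L = x" using assms by (auto simp: L_def)
  have "(\<Sum>k<5. L ^ k / fact k) \<le> exp L"
    unfolding exp_def using L summable_exp_generic[of L]
    by (simp add: scaleR_conv_of_real divide_inverse mult.commute sum_le_suminf)
  then have "1 + L + L\<^sup>2 / 2 + L ^ 3 / 6 + L ^ 4 / 24 \<le> x"
    using L by (simp add: eval_nat_numeral fact_numeral)
  moreover have "0 \<le> L ^ 4 + 4 * L ^ 3 - 36 * L\<^sup>2 + 48 * L + 48"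
  proof -
    \<comment> \<open>A certificate for \<open>L \<ge> 0\<close>: both squares have nonnegative
      factors there. The quartic is smallest close to \<open>L = 12 / 5\<close>.\<close>
    have "L ^ 4 + 4 * L ^ 3 - 36 * L\<^sup>2 + 48 * L + 48
        = (L - 12 / 5)\<^sup>2 * (L\<^sup>2 + 44 / 5 * L + 2 / 5) + 2 / 25 * (L - 24 / 5)\<^sup>2 + 27408 / 625"
      by (simp add: eval_nat_numeral algebra_simps)
    then show ?thesis using L by simp
  qed
  ultimately show ?thesis unfolding L_def[symmetric] by simp
qed

text \<open>The derivative of \<open>- exp (\<theta> x) (1 - x)^n (2 - x)\<close> exceeds \<open>n exp (\<theta> x) (1 - x)^(n - 1)\<close> by a
  multiple of \<open>x (1 - x)\<close>; this avoids the incomplete gamma function.\<close>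
lemma nn_integral_uniform_mgf:
  fixes n :: nat
  assumes "n \<ge> 1"
  shows "(\<integral>\<^sup>+x\<in>{0..1}. ennreal ((exp ((n + 1) / 2 * x) - 1) * (1 - x) ^ (n - 1)) \<partial>lborel) \<le> ennreal (1 / n)"
proof -
  \<comment> \<open>This is \<open>1 / (2 * \<mu>)\<close> for \<open>\<mu> = 1 / (n + 1)\<close>,
    the mean of the minimum of \<open>n\<close> uniform variables.\<close>
  define \<theta> where "\<theta> = (real n + 1) / 2"
  define G :: "real \<Rightarrow> real" where "G x = (- exp (\<theta> * x) * (1 - x) ^ n * (2 - x) + (1 - x) ^ n) / real n" for x
  define g :: "real \<Rightarrow> real" where "g x = (exp (\<theta> * x) * (1 - x) ^ (n - 1) * (real n + (real n + 1) / 2 * (x * (1 - x))) - real n * (1 - x) ^ (n - 1)) / real n" for x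
  obtain k where k: "n = Suc k" using assms by (cases n) auto
  have deriv: "(G has_real_derivative g x) (at x)" for x
  proof -
    define e where "e = exp (\<theta> * x)"
    define q where "q = (1 - x) ^ (n - 1)"
    have q: "(1 - x) ^ n = (1 - x) * q" by (simp add: q_def k)
    have "((\<lambda>x. (1 - x) ^ n) has_real_derivative - (real n * q)) (at x)"
      unfolding q_def by (rule derivative_eq_intros refl | simp)+
    moreover have "((\<lambda>x. exp (\<theta> * x)) has_real_derivative \<theta> * e) (at x)"
      unfolding e_def by (rule derivative_eq_intros refl | simp)+
    ultimately have "(G has_real_derivative ((- (\<theta> * e) * (1 - x) ^ n + - (real n * q) * - exp (\<theta> * x)) * (2 - x)
        + (0 - 1) * (- exp (\<theta> * x) * (1 - x) ^ n) + - (real n * q)) / n) (at x)"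
      unfolding G_def
      by (intro DERIV_cdivide DERIV_add DERIV_mult DERIV_minus DERIV_diff DERIV_const DERIV_ident)
    also have "((- (\<theta> * e) * (1 - x) ^ n + - (real n * q) * - exp (\<theta> * x)) * (2 - x)
        + (0 - 1) * (- exp (\<theta> * x) * (1 - x) ^ n) + - (real n * q)) / n = g x"
      unfolding g_def q e_def[symmetric] q_def[symmetric]
      unfolding \<theta>_def
      by (rule arg_cong[where f = "\<lambda>a. a / real n"]) (simp add: field_simps)
    finally show ?thesis .
  qed
  have le: "(exp (\<theta> * x) - 1) * (1 - x) ^ (n - 1) \<le> g x" if "0 \<le> x" "x \<le> 1" for x
  proof -
    have "0 \<le> exp (\<theta> * x) * (1 - x) ^ (n - 1) * ((n + 1) / 2 * (x * (1 - x))) / n"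
      using that by simp
    then show ?thesis using assms by (simp add: g_def field_simps)
  qed
  have nonneg: "0 \<le> g x" if "0 \<le> x" "x \<le> 1" for x
  proof -
    have "0 \<le> (exp (\<theta> * x) - 1) * (1 - x) ^ (n - 1)"
      using that by (simp add: \<theta>_def)
    with le[OF that] show ?thesis by linarith
  qed
  have "(\<integral>\<^sup>+x\<in>{0..1}. ennreal ((exp (\<theta> * x) - 1) * (1 - x) ^ (n - 1)) \<partial>lborel)
      \<le> (\<integral>\<^sup>+x. ennreal (g x) * indicator {0..1} x \<partial>lborel)"
    using le by (intro nn_integral_mono) (auto split: split_indicator intro!: ennreal_leI)
  also have "\<dots> = G 1 - G 0"
  proof (rule nn_integral_FTC_Icc)
    show "g \<in> borel_measurable borel" unfolding g_def by measurable
  qed (auto simp: nonneg deriv has_field_derivative_at_within)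
  \<comment> \<open>\<open>G\<close> vanishes at 1. At 0 it is \<open>(- 2 + 1) / n\<close>, the 2
    coming from the factor \<open>2 - x\<close>.\<close>
  also have "G 1 - G 0 = 1 / n"
    using assms by (simp add: G_def)
  finally show ?thesis by (simp add: \<theta>_def add.commute)
qed

lemma nn_integral_one_minus_power:
  "(\<integral>\<^sup>+x\<in>{0..1}. ennreal ((1 - x) ^ n) \<partial>lborel) = ennreal (1 / (n + 1))"
proof -
  have "(\<integral>\<^sup>+x\<in>{0..1}. ennreal ((1 - x) ^ n) \<partial>lborel)
      = ennreal (- ((1 - 1) ^ Suc n / Suc n) - - ((1 - 0) ^ Suc n / Suc n))"
    by (rule nn_integral_FTC_Icc) (auto intro!: derivative_eq_intros simp del: power_Suc)
  then show ?thesis by (simp add: add.commute)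
qed

text \<open>The recursion in \<open>k\<close> comes from differentiating \<open>- (1 - x) * (1 - (1 - x) ^ n) ^ Suc k\<close>,
  which vanishes at both endpoints.\<close>
lemma has_integral_one_minus_power_power:
  fixes n k :: nat
  assumes "n \<ge> 1"
  shows "((\<lambda>x. (1 - (1 - x) ^ n) ^ k) has_integral (\<Prod>i=1..k. (real n * real i) / (real n * real i + 1))) {0..1::real}"
proof (induction k)
  case 0
  show ?case using has_integral_const_real[of 1 0 1] by simp
next
  case (Suc k)
  define c where "c = real n * real (Suc k)"
  have c: "c + 1 > 0" by (simp add: c_def add_nonneg_pos)
  define P where "P = (\<Prod>i=1..k. (real n * real i) / (real n * real i + 1))"
  define F where "F x = - (1 - x) * (1 - (1 - x) ^ n) ^ Suc k" for x :: real
  define f where "f x = (c + 1) * (1 - (1 - x) ^ n) ^ Suc k - c * (1 - (1 - x) ^ n) ^ k" for x :: real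
  obtain l where l: "n = Suc l" using assms by (cases n) auto
  have "(f has_integral (F 1 - F 0)) {0..1}"
  proof (rule fundamental_theorem_of_calculus)
    fix x :: real
    have "(F has_real_derivative f x) (at x)"
      unfolding F_def f_def c_def l
      by (rule derivative_eq_intros refl | simp add: algebra_simps)+
    then show "(F has_vector_derivative f x) (at x within {0..1})"
      by (simp add: has_real_derivative_iff_has_vector_derivative has_vector_derivative_at_within)
  qed simp
  moreover have "F 1 - F 0 = 0" using assms by (simp add: F_def)
  \<comment> \<open>Adding \<open>c\<close> times the integrand for \<open>k\<close> to
    \<open>f\<close> leaves \<open>c + 1\<close> times the integrand for
    \<open>Suc k\<close>.\<close>
  ultimately have "((\<lambda>x. (f x + c * (1 - (1 - x) ^ n) ^ k) / (c + 1)) has_integral (0 + c * P) / (c + 1)) {0..1}"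
    by (intro has_integral_divide has_integral_add has_integral_mult_right Suc[folded P_def]) auto
  moreover have "(f x + c * (1 - (1 - x) ^ n) ^ k) / (c + 1) = (1 - (1 - x) ^ n) ^ Suc k" for x
    using c by (simp add: f_def)
  moreover have "(\<Prod>i=1..Suc k. (real n * real i) / (real n * real i + 1)) = (0 + c * P) / (c + 1)"
    by (simp add: P_def c_def)
  ultimately show ?case by simp
qed

text \<open>Cutting the product at \<open>n\<close> and expanding its reciprocal to first order
  bounds the right-hand side below by \<open>H / (n + H)\<close>, where \<open>H = harm n\<close>.
  The comparison with \<open>ln n / (n + 1)\<close> then combines
  \<open>H \<ge> ln n + 1 / 2\<close> with \<open>ln_squared_le\<close>.\<close>

lemma ln_div_le_one_minus_prod:
  assumes "1 \<le> n" "n \<le> m"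
  shows "ln (real n) / (n + 1) \<le> 1 - (\<Prod>i=1..m. (real n * real i) / (real n * real i + 1))"
proof -
  define H where "H = (harm n :: real)"
  define L where "L = ln (real n)"
  have H: "H \<ge> L + 1 / 2" "H \<ge> 0"
    using harm_ge_ln_plus_half[of n] assms by (auto simp: H_def L_def harm_nonneg intro: order_trans[rotated])
  have L: "0 \<le> L" "2 * L\<^sup>2 \<le> n + 1 + L" "L \<le> n - 1"
    using ln_squared_le[of n] ln_le_minus_one[of n] assms by (auto simp: L_def)
  have prod_ge: "1 + (\<Sum>i=1..k. 1 / (real n * real i)) \<le> (\<Prod>i=1..k. 1 + 1 / (real n * real i))" for k
  proof (induction k)
    case (Suc k)
    have "1 + (\<Sum>i=1..Suc k. 1 / (real n * real i)) \<le> (1 + (\<Sum>i=1..k. 1 / (real n * real i))) * (1 + 1 / (real n * Suc k))"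
      by (simp add: algebra_simps sum_nonneg)
    also have "\<dots> \<le> (\<Prod>i=1..k. 1 + 1 / (real n * real i)) * (1 + 1 / (real n * Suc k))"
      using Suc by (intro mult_right_mono) auto
    finally show ?case by simp
  qed simp
  have harm: "(\<Sum>i=1..n. 1 / (real n * real i)) = H / n"
    by (simp add: H_def harm_def sum_divide_distrib field_simps)
  let ?p = "\<lambda>i. (real n * real i) / (real n * real i + 1)"
  have "(\<Prod>i=1..m. ?p i) = (\<Prod>i=1..n. ?p i) * (\<Prod>i=n + 1..m. ?p i)"
    using assms by (subst prod.union_disjoint[symmetric]) (auto intro!: prod.cong)
  also have "\<dots> \<le> (\<Prod>i=1..n. ?p i)"
    by (intro mult_left_le prod_le_1 prod_nonneg) (auto simp: divide_simps add_nonneg_pos)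
  also have "\<dots> = 1 / (\<Prod>i=1..n. 1 + 1 / (real n * real i))"
  proof -
    have "(\<Prod>i=1..n. ?p i) = (\<Prod>i=1..n. 1 / (1 + 1 / (real n * real i)))"
      using assms by (intro prod.cong) (auto simp: field_simps)
    then show ?thesis by (simp only: prod_dividef prod.neutral_const)
  qed
  also have "\<dots> \<le> 1 / (1 + H / n)"
    using prod_ge[of n, unfolded harm] H assms
    by (intro divide_left_mono) (auto intro!: mult_pos_pos add_pos_nonneg prod_pos)
  also have "\<dots> = 1 - H / (n + H)"
    using assms H by (simp add: field_simps)
  finally have "H / (n + H) \<le> 1 - (\<Prod>i=1..m. (real n * real i) / (real n * real i + 1))" by simp
  moreover have "L / (n + 1) \<le> H / (n + H)"
  proof -
    \<comment> \<open>The goal \<open>L * (n + H) \<le> H * (n + 1)\<close> rearranges to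
      \<open>L * n \<le> H * (n + 1 - L)\<close>. Inserting the lower bound for \<open>H\<close>
      reduces it exactly to \<open>2 * L\<^sup>2 \<le> n + 1 + L\<close>.\<close>
    have "(L + 1 / 2) * (n + 1 - L) \<le> H * (n + 1 - L)"
      using H L by (intro mult_right_mono) auto
    moreover have "L * L \<le> (n + 1 + L) / 2"
      using L by (simp add: power2_eq_square)
    ultimately have "L * (n + H) \<le> H * (n + 1)"
      by (simp add: algebra_simps add_divide_distrib)
    then show ?thesis using H assms by (simp add: field_simps)
  qed
  ultimately show ?thesis by (simp add: L_def)
qed

text \<open>The integrand is the tail of the maximum of \<open>m\<close> independent minima of
  \<open>n\<close> uniform variables, so this is \<open>mean_max_min\<close> for
  \<open>\<mu> = 1 / (n + 1)\<close>.\<close>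

lemma nn_integral_uniform_max_min:
  assumes "1 \<le> n" "n \<le> m"
  shows "ennreal (ln n / (n + 1)) \<le> (\<integral>\<^sup>+x\<in>{0..1}. ennreal (1 - (1 - (1 - x) ^ n) ^ m) \<partial>lborel)"
proof -
  have "((\<lambda>x. 1 - (1 - (1 - x) ^ n) ^ m) has_integral (1 - (\<Prod>i=1..m. (real n * real i) / (real n * real i + 1)))) {0..1::real}"
    using has_integral_diff[OF has_integral_const_real[of 1 0 1] has_integral_one_minus_power_power[OF assms(1), of m]]
    by simp
  moreover have "0 \<le> 1 - (1 - (1 - x) ^ n) ^ m" if "x \<in> {0..1}" for x :: real
    using that by (auto intro!: power_le_one)
  ultimately have "(\<integral>\<^sup>+x\<in>{0..1}. ennreal (1 - (1 - (1 - x) ^ n) ^ m) \<partial>lborel)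
      = ennreal (1 - (\<Prod>i=1..m. (real n * real i) / (real n * real i + 1)))"
    by (intro nn_integral_has_integral_lebesgue')
  then show ?thesis using ln_div_le_one_minus_prod[OF assms] by (simp add: ennreal_leI add.commute)
qed

section \<open>Integrals for the exponential law\<close>

lemma tendsto_exp_neg_mult_at_top:
  fixes c :: real
  assumes "0 < c"
  shows "((\<lambda>x. exp (- c * x)) \<longlongrightarrow> 0) at_top"
  using assms by real_asymp

lemma nn_integral_exp_tail:
  fixes c x :: real
  assumes "0 < c"
  shows "(\<integral>\<^sup>+y. ennreal (c * exp (- c * y)) * indicator {x..} y \<partial>lborel) = ennreal (exp (- c * x))"
proof -
  have "((\<lambda>y. - exp (- c * y)) \<longlongrightarrow> 0) at_top"
    using tendsto_minus[OF tendsto_exp_neg_mult_at_top[OF assms]] by simp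
  then have "(\<integral>\<^sup>+y. ennreal (c * exp (- c * y)) * indicator {x..} y \<partial>lborel) = ennreal (0 - - exp (- c * x))"
    using assms by (intro nn_integral_FTC_atLeast) (auto intro!: derivative_eq_intros)
  then show ?thesis by simp
qed

text \<open>This is the mean of the maximum of \<open>m\<close> independent exponential variables of
  rate \<open>c\<close>. With \<open>u = exp (- c * x)\<close>, the geometric sum writes
  \<open>1 - (1 - u) ^ m\<close> as the sum of the terms \<open>u * (1 - u) ^ k\<close>, each of
  which has an explicit antiderivative.\<close>

lemma nn_integral_exp_max:
  assumes c: "0 < c"
  shows "(\<integral>\<^sup>+x\<in>{0..}. ennreal (1 - (1 - exp (- c * x)) ^ m) \<partial>lborel) = ennreal (harm m / c)"
proof -
  define F :: "real \<Rightarrow> real" where "F x = (\<Sum>k<m. (1 - exp (- c * x)) ^ Suc k / (c * Suc k))" for x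
  have deriv: "(F has_real_derivative 1 - (1 - exp (- c * x)) ^ m) (at x)" for x
  proof -
    have "(F has_real_derivative (\<Sum>k<m. (1 - exp (- c * x)) ^ k * exp (- c * x))) (at x)"
      unfolding F_def
    proof (rule DERIV_sum)
      fix k
      have "((\<lambda>x. (1 - exp (- c * x)) ^ Suc k) has_real_derivative
         (c * Suc k) * ((1 - exp (- c * x)) ^ k * exp (- c * x))) (at x)"
        by (rule derivative_eq_intros refl | simp)+
      from DERIV_cdivide[OF this, of "c * Suc k"]
      show "((\<lambda>x. (1 - exp (- c * x)) ^ Suc k / (c * Suc k)) has_real_derivative
         (1 - exp (- c * x)) ^ k * exp (- c * x)) (at x)"
        using c by (simp del: power_Suc of_nat_Suc)
    qed
    also have "(\<Sum>k<m. (1 - exp (- c * x)) ^ k * exp (- c * x)) = 1 - (1 - exp (- c * x)) ^ m"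
      using one_diff_power_eq[of "1 - exp (- c * x)" m] by (simp add: sum_distrib_left mult.commute)
    finally show ?thesis .
  qed
  have "(F \<longlongrightarrow> (\<Sum>k<m. (1 - 0) ^ Suc k / (c * Suc k))) at_top"
    unfolding F_def using c by (intro tendsto_intros tendsto_exp_neg_mult_at_top) auto
  also have "(\<Sum>k<m. (1 - 0) ^ Suc k / (c * Suc k)) = harm m / c"
    by (simp add: harm_altdef sum_divide_distrib field_simps)
  finally have lim: "(F \<longlongrightarrow> harm m / c) at_top" .
  have "(\<integral>\<^sup>+x. ennreal (1 - (1 - exp (- c * x)) ^ m) * indicator {0..} x \<partial>lborel) = harm m / c - F 0"
    using c by (intro nn_integral_FTC_atLeast lim deriv) (auto intro!: power_le_one)
  also have "F 0 = 0" by (simp add: F_def)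
  finally show ?thesis by simp
qed

section \<open>The uniform and the exponential case\<close>

lemma distr_eq_density_of_distributed:
  assumes "distributed M lborel X f"
  shows "distr M borel X = density lborel f"
  using distributed_distr_eq_density[OF assms] by (simp cong: distr_cong)

theorem corollary8:
  fixes M :: "'a measure"
    and t :: "nat \<Rightarrow> nat \<Rightarrow> 'a \<Rightarrow> real"
    and n m :: nat
  assumes "prob_space M"
    and "n \<ge> 1" and "m \<ge> n"
    and "prob_space.indep_vars M (\<lambda>_. borel) (\<lambda>(i, j). t i j) ({1..n} \<times> {1..m})"
    and "(\<forall>i\<in>{1..n}. \<forall>j\<in>{1..m}.
            distributed M lborel (t i j) (\<lambda>x. indicator {0..1} x / measure lborel {0..1::real}))
       \<or> (\<exists>l>0. \<forall>i\<in>{1..n}. \<forall>j\<in>{1..m}.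
            distributed M lborel (t i j) (exponential_density l))"
  shows "prob_space.expectation M (\<lambda>\<omega>. expected_VCG n m (\<lambda>i j. t i j \<omega>))
           \<le> 4 * prob_space.expectation M (\<lambda>\<omega>. OPT n m (\<lambda>i j. t i j \<omega>))"
  using assms(5)
proof (elim disjE exE conjE)
  assume *: "\<forall>i\<in>{1..n}. \<forall>j\<in>{1..m}.
    distributed M lborel (t i j) (\<lambda>x. indicator {0..1} x / measure lborel {0..1::real})"
  let ?D = "density lborel (indicator {0..1::real}) :: real measure"
  let ?S = "\<lambda>x::real. max 0 (1 - x)"
  show ?thesis
  \<comment> \<open>The minimum of \<open>n\<close> uniform variables has tail
    \<open>(1 - x) ^ n\<close> on the unit interval and mean \<open>1 / (n + 1)\<close>;
    \<open>?S\<close> is cut off at 0 to be the tail beyond 1 as well.\<close>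
  proof (rule expected_VCG_le_4_OPT_of_iid[OF assms(1-4), where D = ?D and S = ?S and \<mu> = "1 / (n + 1)"])
    show "distr M borel (t i j) = ?D" if "i \<in> {1..n}" "j \<in> {1..m}" for i j
      using distr_eq_density_of_distributed[OF *[rule_format, OF that]] by (simp add: ennreal_indicator)
    show "AE x in ?D. 0 \<le> x"
      by (subst AE_density) (auto simp: indicator_def)
    show "emeasure ?D {x<..} = ennreal (?S x)" if "0 \<le> x" for x
    proof -
      have "emeasure ?D {x<..} = (\<integral>\<^sup>+y. indicator {0..1} y * indicator {x<..} y \<partial>lborel)"
        by (rule emeasure_density) auto
      also have "\<dots> = (\<integral>\<^sup>+y. indicator {x<..1} y \<partial>lborel)"
        using that by (intro nn_integral_cong) (auto split: split_indicator)
      finally show ?thesis by (cases "x \<le> 1") (auto simp: max_def)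
    qed
    show "emeasure ?D {x..} = ennreal (?S x)" if "0 \<le> x" for x
    proof -
      have "emeasure ?D {x..} = (\<integral>\<^sup>+y. indicator {0..1} y * indicator {x..} y \<partial>lborel)"
        by (rule emeasure_density) auto
      also have "\<dots> = (\<integral>\<^sup>+y. indicator {x..1} y \<partial>lborel)"
        using that by (intro nn_integral_cong) (auto split: split_indicator)
      finally show ?thesis by (cases "x \<le> 1") (auto simp: max_def)
    qed
    have "integrable lborel (\<lambda>x::real. indicator {0..1} x *\<^sub>R x)"
      by (rule borel_integrable_compact) auto
    then show "integrable ?D (\<lambda>x. x)"
      using integrable_density[of "\<lambda>x::real. x" lborel "indicator {0..1}"]
      by (simp add: ennreal_indicator)
    have "(\<integral>\<^sup>+x\<in>{0..1}. ennreal ((1 - x) ^ n) \<partial>lborel) \<le> (\<integral>\<^sup>+x\<in>{0..}. ennreal (?S x ^ n) \<partial>lborel)"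
      by (intro nn_integral_mono) (auto split: split_indicator)
    then show "ennreal (1 / (n + 1)) \<le> (\<integral>\<^sup>+x\<in>{0..}. ennreal (?S x ^ n) \<partial>lborel)"
      by (simp add: nn_integral_one_minus_power add.commute)
    have "(\<integral>\<^sup>+x\<in>{0..1}. ennreal (1 - (1 - (1 - x) ^ n) ^ m) \<partial>lborel)
        \<le> (\<integral>\<^sup>+x\<in>{0..}. ennreal (1 - (1 - ?S x ^ n) ^ m) \<partial>lborel)"
      by (intro nn_integral_mono) (auto split: split_indicator)
    with nn_integral_uniform_max_min[OF assms(2,3)]
    show "ennreal (1 / (n + 1) * ln n) \<le> (\<integral>\<^sup>+x\<in>{0..}. ennreal (1 - (1 - ?S x ^ n) ^ m) \<partial>lborel)"
      by (simp add: add.commute)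
    have "(\<integral>\<^sup>+x. ennreal ((exp (x / (2 * (1 / (n + 1)))) - 1) * ?S x ^ (n - 1)) \<partial>?D)
        = (\<integral>\<^sup>+x\<in>{0..1}. ennreal ((exp ((n + 1) / 2 * x) - 1) * (1 - x) ^ (n - 1)) \<partial>lborel)"
      by (subst nn_integral_density) (auto intro!: nn_integral_cong split: split_indicator simp: mult.commute)
    then show "(\<integral>\<^sup>+x. ennreal ((exp (x / (2 * (1 / (n + 1)))) - 1) * ?S x ^ (n - 1)) \<partial>?D) \<le> ennreal (1 / n)"
      using nn_integral_uniform_mgf[OF assms(2)] by simp
  qed (auto simp: max_def)
next
  fix l :: real
  assume l: "0 < l"
    and *: "\<forall>i\<in>{1..n}. \<forall>j\<in>{1..m}. distributed M lborel (t i j) (exponential_density l)"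
  let ?D = "density lborel (exponential_density l)"
  let ?S = "\<lambda>x::real. exp (- l * x)"
  have pow: "?S x ^ k = exp (- (k * l) * x)" for x k
    by (simp flip: exp_of_nat_mult)
  have nl: "0 < n * l" using assms(2) l by simp
  show ?thesis
  \<comment> \<open>The minimum of \<open>n\<close> exponential variables of rate \<open>l\<close>
    is exponential of rate \<open>n * l\<close>, hence has mean \<open>1 / (n * l)\<close>.\<close>
  proof (rule expected_VCG_le_4_OPT_of_iid[OF assms(1-4), where D = ?D and S = ?S and \<mu> = "1 / (n * l)"])
    show "distr M borel (t i j) = ?D" if "i \<in> {1..n}" "j \<in> {1..m}" for i j
      using distr_eq_density_of_distributed[OF *[rule_format, OF that]] .
    show "AE x in ?D. 0 \<le> x"
      by (subst AE_density) (auto simp: exponential_density_def)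
    show ge: "emeasure ?D {x..} = ennreal (?S x)" if "0 \<le> x" for x
    proof -
      have "emeasure ?D {x..} = (\<integral>\<^sup>+y. ennreal (l * exp (- l * y)) * indicator {x..} y \<partial>lborel)"
        using that by (subst emeasure_density)
          (auto intro!: nn_integral_cong split: split_indicator simp: exponential_density_def mult.commute)
      then show ?thesis using nn_integral_exp_tail[OF l] by simp
    qed
    show "emeasure ?D {x<..} = ennreal (?S x)" if "0 \<le> x" for x
    proof -
      have "emeasure ?D {x<..} = emeasure ?D {x..}"
      proof (rule emeasure_eq_AE)
        show "AE y in ?D. (y \<in> {x<..}) = (y \<in> {x..})"
          using AE_lborel_singleton[of x] by (subst AE_density) (auto elim: eventually_mono)
      qed auto
      then show ?thesis using ge[OF that] by simp
    qed
    have "1 \<in> {1..n}" "1 \<in> {1..m}" using assms(2,3) by auto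
    note t11 = *[rule_format, OF this]
    have "integrable M (t 1 1)"
      using prob_space.erlang_ith_moment_integrable[OF assms(1) l t11, of 1] by simp
    then show "integrable ?D (\<lambda>x. x)"
      unfolding distr_eq_density_of_distributed[OF t11, symmetric]
      using distributed_measurable[OF t11] by (subst integrable_distr_eq) auto
    have "(\<integral>\<^sup>+x\<in>{0..}. ennreal (?S x ^ n) \<partial>lborel)
        = (\<integral>\<^sup>+x. ennreal (1 / (n * l)) * (ennreal ((n * l) * exp (- (n * l) * x)) * indicator {0..} x) \<partial>lborel)"
      unfolding pow using assms(2) l
      by (intro nn_integral_cong) (auto split: split_indicator simp flip: ennreal_mult)
    also have "\<dots> = ennreal (1 / (n * l))"
      using nn_integral_exp_tail[OF nl, of 0] by (subst nn_integral_cmult) auto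
    finally show "ennreal (1 / (n * l)) \<le> (\<integral>\<^sup>+x\<in>{0..}. ennreal (?S x ^ n) \<partial>lborel)" by simp
    \<comment> \<open>The mean of the maximum of the \<open>m\<close> minima is
      \<open>harm m / (n * l)\<close>, so \<open>mean_max_min\<close> reduces to this inequality,
      where \<open>n \<le> m\<close> enters.\<close>
    have "ln (real n) \<le> harm m"
    proof -
      have "ln (real n) \<le> ln (real m + 1)" using assms(2,3) by (subst ln_le_cancel_iff) auto
      also have "\<dots> \<le> harm m" by (rule harm_ge_ln)
      finally show ?thesis .
    qed
    then have "1 / (n * l) * ln n \<le> harm m / (n * l)"
      using nl by (simp add: divide_right_mono)
    then show "ennreal (1 / (n * l) * ln n) \<le> (\<integral>\<^sup>+x\<in>{0..}. ennreal (1 - (1 - ?S x ^ n) ^ m) \<partial>lborel)"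
      unfolding pow nn_integral_exp_max[OF nl] by (rule ennreal_leI)
    \<comment> \<open>\<open>?c\<close> is \<open>1 / (2 * \<mu>)\<close>, half the rate of the
      minimum. Multiplying \<open>exp (- (n * l) * x)\<close> by \<open>exp (?c * x)\<close>
      therefore leaves \<open>exp (- ?c * x)\<close>, which is integrable.\<close>
    let ?c = "n * l / 2"
    have c: "0 < ?c" using nl by simp
    have "(\<integral>\<^sup>+x. ennreal ((exp (x / (2 * (1 / (n * l)))) - 1) * ?S x ^ (n - 1)) \<partial>?D)
        = (\<integral>\<^sup>+x. ennreal (l * exp (- ?c * x) - l * exp (- (n * l) * x)) * indicator {0..} x \<partial>lborel)"
    proof (subst nn_integral_density)
      show "(\<integral>\<^sup>+x. ennreal (exponential_density l x) * ennreal ((exp (x / (2 * (1 / (n * l)))) - 1) * ?S x ^ (n - 1)) \<partial>lborel)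
        = (\<integral>\<^sup>+x. ennreal (l * exp (- ?c * x) - l * exp (- (n * l) * x)) * indicator {0..} x \<partial>lborel)"
      proof (intro nn_integral_cong)
        fix x :: real
        have 1: "exp (- l * x) * ?S x ^ (n - 1) = exp (- (n * l) * x)"
          using assms(2) unfolding pow exp_add[symmetric]
          by (intro arg_cong[where f = exp]) (simp add: of_nat_diff algebra_simps)
        have 2: "exp (?c * x) * exp (- (n * l) * x) = exp (- ?c * x)"
          unfolding exp_add[symmetric] by (intro arg_cong[where f = exp]) (simp add: field_simps)
        have "(l * exp (- l * x)) * ((exp (?c * x) - 1) * ?S x ^ (n - 1))
          = l * (exp (?c * x) * (exp (- l * x) * ?S x ^ (n - 1))) - l * (exp (- l * x) * ?S x ^ (n - 1))"
          by (simp add: algebra_simps)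
        also have "\<dots> = l * exp (- ?c * x) - l * exp (- (n * l) * x)"
          by (simp only: 1 2)
        finally show "ennreal (exponential_density l x) * ennreal ((exp (x / (2 * (1 / (n * l)))) - 1) * ?S x ^ (n - 1))
          = ennreal (l * exp (- ?c * x) - l * exp (- (n * l) * x)) * indicator {0..} x"
          using l by (auto simp: exponential_density_def mult.commute split: split_indicator simp flip: ennreal_mult')
      qed
    qed auto
    also have "\<dots> = ennreal (0 - (- 2 / n + 1 / n))"
    proof -
      \<comment> \<open>An antiderivative of the difference of the two exponentials. Its value
        \<open>- 1 / n\<close> at 0 makes the integral exactly \<open>1 / n\<close>.\<close>
      let ?F = "\<lambda>x. - (2 / n) * exp (- ?c * x) + (1 / n) * exp (- (n * l) * x)"
      have "(?F \<longlongrightarrow> 0) at_top"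
        using tendsto_add[OF tendsto_mult[OF tendsto_const[of "- (2 / n)"] tendsto_exp_neg_mult_at_top[OF c]]
          tendsto_mult[OF tendsto_const[of "1 / n"] tendsto_exp_neg_mult_at_top[OF nl]]] by simp
      then have "(\<integral>\<^sup>+x. ennreal (l * exp (- ?c * x) - l * exp (- (n * l) * x)) * indicator {0..} x \<partial>lborel)
        = ennreal (0 - ?F 0)"
        using assms(2) l by (intro nn_integral_FTC_atLeast) (auto intro!: derivative_eq_intros)
      then show ?thesis by simp
    qed
    finally show "(\<integral>\<^sup>+x. ennreal ((exp (x / (2 * (1 / (n * l)))) - 1) * ?S x ^ (n - 1)) \<partial>?D) \<le> ennreal (1 / n)"
      by simp
  qed (use nl l in auto)
qed

end
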